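(* Let $f:G\to H$ and $g:K\to H$ be continuous homomorphisms of topological groups, and let $G\times_H K=\{(x,y)\in G\times K : f(x)=g(y)\}$ (with the subspace topology of $G\times K$) be their pullback. If $f$ is c-proper and $K$ is c-compact, then $G\times_H K$ is c-compact.
   Context: Topological groups are not assumed to be Hausdorff. A continuous homomorphism $f:G\to H$ is c-closed if $f(A)$ is closed in $H$ for every closed subgroup $A\le G$. It is c-proper if for every topological group $K$ and every continuous homomorphism $g:K\to H$, the projection $p_2: G\times_H K\to K$ from the pullback is c-closed. A topological group $G$ is c-compact if the homomorphism $G\to 1$ to the trivial group is c-proper; equivalently, if the projection $G\times K\to K$ is c-closed for every topological group $K$. *)

theory Defs
  imports "HOL-Analysis.Analysis" "HOL-Algebra.Algebra"
begin

locale topological_group = group G for G :: "('a, 'm) monoid_scheme" (structure) and T :: "'a topology" +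
  assumes topspace_eq: "topspace T = carrier G"
    and continuous_mult: "continuous_map (prod_topology T T) T (\<lambda>(x, y). x \<otimes> y)"
    and continuous_inv: "continuous_map T T (\<lambda>x. inv x)"

definition topological_group_hom ::
  "('a, 'm) monoid_scheme \<Rightarrow> 'a topology \<Rightarrow> ('b, 'n) monoid_scheme \<Rightarrow> 'b topology \<Rightarrow> ('a \<Rightarrow> 'b) \<Rightarrow> bool"
where
  "topological_group_hom G S H T f \<longleftrightarrow>
     topological_group G S \<and> topological_group H T \<and> f \<in> hom G H \<and> continuous_map S T f"

definition pullback_set ::
  "('a, 'm) monoid_scheme \<Rightarrow> ('b, 'n) monoid_scheme \<Rightarrow> ('a \<Rightarrow> 'c) \<Rightarrow> ('b \<Rightarrow> 'c) \<Rightarrow> ('a \<times> 'b) set"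
where
  "pullback_set G K f g = {(x, y) \<in> carrier G \<times> carrier K. f x = g y}"

definition pullback_group ::
  "('a, 'm) monoid_scheme \<Rightarrow> ('b, 'n) monoid_scheme \<Rightarrow> ('a \<Rightarrow> 'c) \<Rightarrow> ('b \<Rightarrow> 'c) \<Rightarrow> ('a \<times> 'b) monoid"
where
  "pullback_group G K f g = (G \<times>\<times> K)\<lparr>carrier := pullback_set G K f g\<rparr>"

definition pullback_top ::
  "('a, 'm) monoid_scheme \<Rightarrow> 'a topology \<Rightarrow> ('b, 'n) monoid_scheme \<Rightarrow> 'b topology
     \<Rightarrow> ('a \<Rightarrow> 'c) \<Rightarrow> ('b \<Rightarrow> 'c) \<Rightarrow> ('a \<times> 'b) topology"
where
  "pullback_top G S K U f g = subtopology (prod_topology S U) (pullback_set G K f g)"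

definition c_closed ::
  "('a, 'm) monoid_scheme \<Rightarrow> 'a topology \<Rightarrow> ('b, 'n) monoid_scheme \<Rightarrow> 'b topology \<Rightarrow> ('a \<Rightarrow> 'b) \<Rightarrow> bool"
where
  "c_closed G S H T f \<longleftrightarrow>
     topological_group_hom G S H T f \<and>
     (\<forall>A. subgroup A G \<and> closedin S A \<longrightarrow> closedin T (f ` A))"

text \<open>
  A formula of HOL cannot quantify over types, so the test groups \<open>K\<close> below range over the
  topological groups with elements in the type \<open>'a list\<close>, where \<open>'a\<close> is the type of the
  elements of \<open>G\<close>. Up to isomorphism these are the topological groups whose cardinality is at
  most that of \<open>'a\<close>, or countable. This is no restriction: theorem
  \<open>c_proper_pullback_c_closed\<close> derives the condition for test groups over an arbitrary type.
  The reason is that if the image of a closed subgroup \<open>A\<close> of the pullback is not closed, this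
  is already visible in a quotient of the subgroup of \<open>K\<close> generated by that image and one of
  its limit points, and this quotient is small.
\<close>

definition c_proper ::
  "('a, 'm) monoid_scheme \<Rightarrow> 'a topology \<Rightarrow> ('b, 'n) monoid_scheme \<Rightarrow> 'b topology \<Rightarrow> ('a \<Rightarrow> 'b) \<Rightarrow> bool"
where
  "c_proper G S H T f \<longleftrightarrow>
     topological_group_hom G S H T f \<and>
     (\<forall>(K :: 'a list monoid) U g. topological_group_hom K U H T g \<longrightarrow>
        c_closed (pullback_group G K f g) (pullback_top G S K U f g) K U snd)"

definition c_compact :: "('a, 'm) monoid_scheme \<Rightarrow> 'a topology \<Rightarrow> bool"
where
  "c_compact G S \<longleftrightarrow>
     c_proper G S (singleton_group ()) (discrete_topology {()}) (\<lambda>_. ())"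

lemma topological_groupI:
  assumes "group G" "topspace T = carrier G"
    "continuous_map (prod_topology T T) T (\<lambda>(x, y). x \<otimes>\<^bsub>G\<^esub> y)"
    "continuous_map T T (\<lambda>x. inv\<^bsub>G\<^esub> x)"
  shows "topological_group G T"
  using assms by (simp add: topological_group_def topological_group_axioms_def)

lemma topological_group_singleton:
  "topological_group (singleton_group ()) (discrete_topology {()})"
  by (rule topological_groupI) (auto simp: continuous_map_def simp flip: prod_topology_discrete_topology)

lemma topological_group_hom_singleton:
  assumes "topological_group G S"
  shows "topological_group_hom G S (singleton_group ()) (discrete_topology {()}) (\<lambda>_. ())"
  using assms topological_group_singleton
  by (auto simp: topological_group_hom_def hom_def)

lemma topological_group_DirProd:
  assumes "topological_group G S" "topological_group H T"
  shows "topological_group (G \<times>\<times> H) (prod_topology S T)"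
proof -
  interpret G: topological_group G S by fact
  interpret H: topological_group H T by fact
  let ?P = "prod_topology S T"
  have 1: "continuous_map (prod_topology ?P ?P) S (\<lambda>p. fst (fst p) \<otimes>\<^bsub>G\<^esub> fst (snd p))"
  proof -
    have "continuous_map (prod_topology ?P ?P) (prod_topology S S) (\<lambda>p. (fst (fst p), fst (snd p)))"
      unfolding continuous_map_pairwise o_def
      using continuous_map_compose[OF continuous_map_fst[of ?P ?P] continuous_map_fst]
        continuous_map_compose[OF continuous_map_snd[of ?P ?P] continuous_map_fst]
      by (simp add: o_def)
    from continuous_map_compose[OF this G.continuous_mult] show ?thesis by (simp add: o_def)
  qed
  have 2: "continuous_map (prod_topology ?P ?P) T (\<lambda>p. snd (fst p) \<otimes>\<^bsub>H\<^esub> snd (snd p))"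
  proof -
    have "continuous_map (prod_topology ?P ?P) (prod_topology T T) (\<lambda>p. (snd (fst p), snd (snd p)))"
      unfolding continuous_map_pairwise o_def
      using continuous_map_compose[OF continuous_map_fst[of ?P ?P] continuous_map_snd]
        continuous_map_compose[OF continuous_map_snd[of ?P ?P] continuous_map_snd]
      by (simp add: o_def)
    from continuous_map_compose[OF this H.continuous_mult] show ?thesis by (simp add: o_def)
  qed
  show ?thesis
  proof (rule topological_groupI)
    show "group (G \<times>\<times> H)" by (simp add: DirProd_group G.is_group H.is_group)
    show "topspace ?P = carrier (G \<times>\<times> H)" by (simp add: G.topspace_eq H.topspace_eq)
    show "continuous_map (prod_topology ?P ?P) ?P (\<lambda>(x, y). x \<otimes>\<^bsub>G \<times>\<times> H\<^esub> y)"
      using 1 2 by (simp add: continuous_map_pairwise o_def case_prod_unfold mult_DirProd')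
    have "continuous_map ?P ?P (\<lambda>x. (inv\<^bsub>G\<^esub> fst x, inv\<^bsub>H\<^esub> snd x))"
      unfolding continuous_map_pairwise o_def
      using continuous_map_compose[OF continuous_map_fst[of S T] G.continuous_inv]
        continuous_map_compose[OF continuous_map_snd[of S T] H.continuous_inv] by (simp add: o_def)
    then show "continuous_map ?P ?P (\<lambda>x. inv\<^bsub>G \<times>\<times> H\<^esub> x)"
      by (rule continuous_map_eq)
        (auto simp: G.topspace_eq H.topspace_eq inv_DirProd G.is_group H.is_group)
  qed
qed

lemma topological_group_subgroup:
  assumes "topological_group G S" "subgroup A G"
  shows "topological_group (G\<lparr>carrier := A\<rparr>) (subtopology S A)"
proof -
  interpret G: topological_group G S by fact
  interpret A: subgroup A G by fact
  show ?thesis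
  proof (rule topological_groupI)
    show "group (G\<lparr>carrier := A\<rparr>)" using assms(2) G.subgroup_imp_group by blast
    show "topspace (subtopology S A) = carrier (G\<lparr>carrier := A\<rparr>)"
      using A.subset by (auto simp: G.topspace_eq)
    show "continuous_map (prod_topology (subtopology S A) (subtopology S A)) (subtopology S A)
       (\<lambda>(x, y). x \<otimes>\<^bsub>G\<lparr>carrier := A\<rparr>\<^esub> y)"
      using continuous_map_from_subtopology[OF G.continuous_mult, of "A \<times> A"]
      by (auto simp: continuous_map_in_subtopology subtopology_Times A.m_closed)
    have "continuous_map (subtopology S A) (subtopology S A) (\<lambda>x. inv\<^bsub>G\<^esub> x)"
      using continuous_map_from_subtopology[OF G.continuous_inv, of A]
      by (auto simp: continuous_map_in_subtopology)
    then show "continuous_map (subtopology S A) (subtopology S A) (\<lambda>x. inv\<^bsub>G\<lparr>carrier := A\<rparr>\<^esub> x)"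
      by (rule continuous_map_eq) (auto simp: G.m_inv_consistent assms(2))
  qed
qed

lemma subgroup_pullback_set:
  assumes "group G" "group K" "group H" "f \<in> hom G H" "g \<in> hom K H"
  shows "subgroup (pullback_set G K f g) (G \<times>\<times> K)"
proof -
  interpret G: group G by fact
  interpret K: group K by fact
  interpret H: group H by fact
  interpret f: group_hom G H f by unfold_locales fact
  interpret g: group_hom K H g by unfold_locales fact
  interpret P: group "G \<times>\<times> K" by (simp add: DirProd_group assms)
  show ?thesis
    by (rule P.subgroupI) (auto simp: pullback_set_def inv_DirProd assms intro!: exI[of _ "\<one>\<^bsub>G\<^esub>"] exI[of _ "\<one>\<^bsub>K\<^esub>"])
qed

lemma topological_group_pullback:
  assumes "topological_group_hom G S H T f" "topological_group_hom K U H T g"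
  shows "topological_group (pullback_group G K f g) (pullback_top G S K U f g)"
  unfolding pullback_group_def pullback_top_def
  using assms
  by (intro topological_group_subgroup topological_group_DirProd subgroup_pullback_set)
    (auto simp: topological_group_hom_def topological_group_def)

lemma topological_group_hom_pullback_snd:
  assumes "topological_group_hom G S H T f" "topological_group_hom K U H T g"
  shows "topological_group_hom (pullback_group G K f g) (pullback_top G S K U f g) K U snd"
  using assms topological_group_pullback[OF assms]
  unfolding topological_group_hom_def
  by (auto simp: pullback_group_def pullback_top_def pullback_set_def hom_def
      intro!: continuous_map_from_subtopology continuous_map_snd)

lemma card_of_generate:
  includes cardinal_syntax
  assumes "group G" "B \<subseteq> carrier G" "infinite (UNIV :: 'u set)" "|B| \<le>o |UNIV :: 'u set|"
  shows "|generate G B| \<le>o |UNIV :: 'u set|"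
proof -
  interpret group G by fact
  let ?C = "B \<union> m_inv G ` B"
  have C: "?C \<subseteq> carrier G" using assms(2) by auto
  have fold_closed: "foldr (\<otimes>\<^bsub>G\<^esub>) xs \<one>\<^bsub>G\<^esub> \<in> carrier G" if "xs \<in> lists ?C" for xs
    using that C by (induction xs) auto
  have fold_append: "foldr (\<otimes>\<^bsub>G\<^esub>) (xs @ ys) \<one>\<^bsub>G\<^esub>
      = foldr (\<otimes>\<^bsub>G\<^esub>) xs \<one>\<^bsub>G\<^esub> \<otimes>\<^bsub>G\<^esub> foldr (\<otimes>\<^bsub>G\<^esub>) ys \<one>\<^bsub>G\<^esub>"
    if "xs \<in> lists ?C" "ys \<in> lists ?C" for xs ys
    using that(1)
  proof (induction xs)
    case Nil
    then show ?case using fold_closed[OF that(2)] by simp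
  next
    case (Cons x xs)
    have "x \<in> carrier G" using Cons(1) C by blast
    then show ?case using Cons fold_closed[OF that(2)] fold_closed[of xs] by (simp add: m_assoc)
  qed
  have "y \<in> (\<lambda>xs. foldr (\<otimes>\<^bsub>G\<^esub>) xs \<one>\<^bsub>G\<^esub>) ` lists ?C" if "y \<in> generate G B" for y
    using that
  proof induction
    case one
    show ?case by (rule image_eqI[of _ _ "[]"]) auto
  next
    case (incl h)
    then show ?case using C by (intro image_eqI[of _ _ "[h]"]) auto
  next
    case (inv h)
    then show ?case using C by (intro image_eqI[of _ _ "[inv\<^bsub>G\<^esub> h]"]) auto
  next
    case (eng h1 h2)
    then obtain xs ys where "xs \<in> lists ?C" "ys \<in> lists ?C" "h1 = foldr (\<otimes>\<^bsub>G\<^esub>) xs \<one>\<^bsub>G\<^esub>"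
      "h2 = foldr (\<otimes>\<^bsub>G\<^esub>) ys \<one>\<^bsub>G\<^esub>" by blast
    then show ?case using fold_append by (intro image_eqI[of _ _ "xs @ ys"]) auto
  qed
  then have "|generate G B| \<le>o |lists ?C|" by (intro surj_imp_ordLeq) blast
  also have "|?C| \<le>o |UNIV :: 'u set|"
    using assms(3,4) card_of_image ordLeq_transitive card_of_Un_ordLeq_infinite by metis
  then have "|lists ?C| \<le>o |lists (UNIV :: 'u set)|" by (rule card_of_lists_mono)
  also have "|lists (UNIV :: 'u set)| =o |UNIV :: 'u set|"
    using assms(3) by (rule card_of_lists_infinite)
  finally show ?thesis .
qed

context topological_group
begin

lemma continuous_map_mult:
  assumes "continuous_map Z T f" "continuous_map Z T g"
  shows "continuous_map Z T (\<lambda>x. f x \<otimes> g x)"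
proof -
  have "continuous_map Z (prod_topology T T) (\<lambda>x. (f x, g x))"
    using assms by (simp add: continuous_map_pairwise o_def)
  from continuous_map_compose[OF this continuous_mult] show ?thesis by (simp add: o_def)
qed

lemma continuous_map_inv:
  assumes "continuous_map Z T f"
  shows "continuous_map Z T (\<lambda>x. inv (f x))"
  using continuous_map_compose[OF assms continuous_inv] by (simp add: o_def)

lemma continuous_map_const_carrier:
  "a \<in> carrier G \<Longrightarrow> continuous_map Z T (\<lambda>x. a)"
  by (simp add: topspace_eq)

end

lemma open_map_prod_map:
  assumes f: "open_map S S' f" and g: "open_map Y Y' g"
  shows "open_map (prod_topology S Y) (prod_topology S' Y') (map_prod f g)"
  unfolding open_map_def openin_prod_topology_alt
proof (intro allI impI)
  fix W x' y'
  assume W: "\<forall>x y. (x, y) \<in> W \<longrightarrow> (\<exists>U V. openin S U \<and> openin Y V \<and> x \<in> U \<and> y \<in> V \<and> U \<times> V \<subseteq> W)"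
    and "(x', y') \<in> map_prod f g ` W"
  from this(2) obtain x y where xy: "(x, y) \<in> W" "x' = f x" "y' = g y"
    unfolding image_iff by (metis map_prod_simp prod.collapse prod.inject)
  from W[rule_format, OF xy(1)] obtain U V
    where UV: "openin S U" "openin Y V" "x \<in> U" "y \<in> V" "U \<times> V \<subseteq> W" by metis
  have "map_prod f g ` (U \<times> V) = f ` U \<times> g ` V" by (rule map_prod_surj_on) (rule refl)+
  then have "f ` U \<times> g ` V \<subseteq> map_prod f g ` W" using UV(5) by (metis image_mono)
  moreover have "openin S' (f ` U)" "openin Y' (g ` V)"
    using f g UV(1,2) unfolding open_map_def by metis+
  moreover have "x' \<in> f ` U" "y' \<in> g ` V" using xy(2,3) UV(3,4) by simp_all
  ultimately show "\<exists>U V. openin S' U \<and> openin Y' V \<and> x' \<in> U \<and> y' \<in> V \<and> U \<times> V \<subseteq> map_prod f g ` W"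
    by metis
qed

lemma topological_group_quotient:
  fixes e :: "'k set \<Rightarrow> 'u"
  assumes "topological_group K U" "N \<lhd> K" "inj_on e (carrier (K Mod N))"
  obtains L :: "'u monoid" and V q where
    "topological_group L V" "q \<in> hom K L" "q ` carrier K = carrier L"
    "\<And>x y. x \<in> carrier K \<Longrightarrow> y \<in> carrier K \<Longrightarrow> q x = q y \<longleftrightarrow> x \<otimes>\<^bsub>K\<^esub> inv\<^bsub>K\<^esub> y \<in> N"
    "continuous_map U V q" "open_map U V q"
proof -
  interpret K: topological_group K U by fact
  interpret N: normal N K by fact
  let ?Q = "K Mod N"
  interpret Q: group ?Q by (rule N.factorgroup_is_group)
  define i where "i = inv_into (carrier ?Q) e"
  have i: "i (e c) = c" if "c \<in> carrier ?Q" for c using that assms(3) by (simp add: i_def)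
  define L where "L = \<lparr>carrier = e ` carrier ?Q, monoid.mult = (\<lambda>x y. e (i x \<otimes>\<^bsub>?Q\<^esub> i y)), one = e \<one>\<^bsub>?Q\<^esub>\<rparr>"
  have iso: "e \<in> iso ?Q L"
    using assms(3) by (auto simp: iso_def hom_def bij_betw_def L_def i)
  have "group L" using Q.iso_imp_img_group[OF iso] by (simp add: L_def)
  then interpret L: group L .
  define q where "q = (\<lambda>k. e (N #>\<^bsub>K\<^esub> k))"
  have qhom: "q \<in> hom K L"
    using hom_compose[OF N.r_coset_hom_Mod iso_imp_homomorphism[OF iso]] by (simp add: q_def o_def)
  interpret q: group_hom K L q by unfold_locales fact
  have cQ: "carrier ?Q = (\<lambda>k. N #>\<^bsub>K\<^esub> k) ` carrier K"
    by (auto simp: FactGroup_def RCOSETS_def)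
  then have qim: "q ` carrier K = carrier L" by (auto simp: L_def q_def)
  have qeq: "q x = q y \<longleftrightarrow> x \<otimes>\<^bsub>K\<^esub> inv\<^bsub>K\<^esub> y \<in> N" if "x \<in> carrier K" "y \<in> carrier K" for x y
  proof -
    have "q x = q y \<longleftrightarrow> N #>\<^bsub>K\<^esub> x = N #>\<^bsub>K\<^esub> y"
      unfolding q_def using that cQ by (intro inj_on_eq_iff[OF assms(3)]) blast+
    also have "\<dots> \<longleftrightarrow> N #>\<^bsub>K\<^esub> (x \<otimes>\<^bsub>K\<^esub> inv\<^bsub>K\<^esub> y) = N"
      using that K.coset_mult_inv1[of N x y] K.coset_mult_inv2[of N x y] N.subset by blast
    also have "\<dots> \<longleftrightarrow> x \<otimes>\<^bsub>K\<^esub> inv\<^bsub>K\<^esub> y \<in> N"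
      using that K.coset_join1[OF _ _ N.subgroup_axioms, of "x \<otimes>\<^bsub>K\<^esub> inv\<^bsub>K\<^esub> y"]
        K.coset_join2[OF _ N.subgroup_axioms, of "x \<otimes>\<^bsub>K\<^esub> inv\<^bsub>K\<^esub> y"]
      by (metis K.inv_closed K.m_closed)
    finally show ?thesis .
  qed
  define V where "V = topology (\<lambda>W. W \<subseteq> carrier L \<and> openin U {k \<in> carrier K. q k \<in> W})"
  have "istopology (\<lambda>W. W \<subseteq> carrier L \<and> openin U {k \<in> carrier K. q k \<in> W})"
    unfolding istopology_def
  proof (intro conjI allI impI)
    fix S T assume "S \<subseteq> carrier L \<and> openin U {k \<in> carrier K. q k \<in> S}"
      "T \<subseteq> carrier L \<and> openin U {k \<in> carrier K. q k \<in> T}"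
    moreover have "{k \<in> carrier K. q k \<in> S \<inter> T} = {k \<in> carrier K. q k \<in> S} \<inter> {k \<in> carrier K. q k \<in> T}"
      by auto
    ultimately show "S \<inter> T \<subseteq> carrier L" "openin U {k \<in> carrier K. q k \<in> S \<inter> T}" by auto
  next
    fix \<K> assume *: "\<forall>S\<in>\<K>. S \<subseteq> carrier L \<and> openin U {k \<in> carrier K. q k \<in> S}"
    moreover have "{k \<in> carrier K. q k \<in> \<Union>\<K>} = (\<Union>S\<in>\<K>. {k \<in> carrier K. q k \<in> S})" by auto
    ultimately show "\<Union>\<K> \<subseteq> carrier L" "openin U {k \<in> carrier K. q k \<in> \<Union>\<K>}" by auto
  qed
  then have V: "openin V W \<longleftrightarrow> W \<subseteq> carrier L \<and> openin U {k \<in> carrier K. q k \<in> W}" for W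
    by (simp add: V_def)
  have "{k \<in> carrier K. q k \<in> carrier L} = topspace U" by (auto simp: K.topspace_eq)
  then have "openin V (carrier L)" by (simp add: V)
  then have topV: "topspace V = carrier L"
    using V[of "topspace V"] openin_subset[of V "carrier L"] openin_topspace[of V] by blast
  have qcont: "continuous_map U V q"
    by (auto simp: continuous_map_def V K.topspace_eq topV)
  have qopen: "open_map U V q"
    unfolding open_map_def
  proof (intro allI impI)
    fix W assume W: "openin U W"
    then have WK: "W \<subseteq> carrier K" using openin_subset K.topspace_eq by blast
    have "{k \<in> carrier K. q k \<in> q ` W} = (\<Union>n\<in>N. {k \<in> topspace U. n \<otimes>\<^bsub>K\<^esub> k \<in> W})"
    proof (intro equalityI subsetI)
      fix k assume "k \<in> {k \<in> carrier K. q k \<in> q ` W}"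
      then obtain w where k: "k \<in> carrier K" "w \<in> W" "q w = q k" by auto
      then have "w \<otimes>\<^bsub>K\<^esub> inv\<^bsub>K\<^esub> k \<in> N" "w \<in> carrier K" using qeq WK by auto
      then show "k \<in> (\<Union>n\<in>N. {k \<in> topspace U. n \<otimes>\<^bsub>K\<^esub> k \<in> W})"
        using k by (auto intro!: bexI[of _ "w \<otimes>\<^bsub>K\<^esub> inv\<^bsub>K\<^esub> k"] simp: K.topspace_eq K.m_assoc)
    next
      fix k assume "k \<in> (\<Union>n\<in>N. {k \<in> topspace U. n \<otimes>\<^bsub>K\<^esub> k \<in> W})"
      then obtain n where n: "n \<in> N" "k \<in> carrier K" "n \<otimes>\<^bsub>K\<^esub> k \<in> W" by (auto simp: K.topspace_eq)
      then have "q (n \<otimes>\<^bsub>K\<^esub> k) = q k" using N.subset by (subst qeq) (auto simp: K.m_assoc)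
      then show "k \<in> {k \<in> carrier K. q k \<in> q ` W}" using n by (auto intro: rev_image_eqI)
    qed
    moreover have "openin U {k \<in> topspace U. n \<otimes>\<^bsub>K\<^esub> k \<in> W}" if "n \<in> N" for n
      using that N.subset W
      by (intro openin_continuous_map_preimage[of U U "\<lambda>k. n \<otimes>\<^bsub>K\<^esub> k"] K.continuous_map_mult K.continuous_map_const_carrier) auto
    ultimately show "openin V (q ` W)" using WK by (auto simp: V)
  qed
  have quo: "quotient_map U V q"
    by (rule continuous_open_imp_quotient_map[OF qcont qopen]) (simp add: K.topspace_eq topV qim)
  have quo2: "quotient_map (prod_topology U U) (prod_topology V V) (map_prod q q)"
  proof (rule continuous_open_imp_quotient_map)
    show "continuous_map (prod_topology U U) (prod_topology V V) (map_prod q q)"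
      using qcont by (simp add: map_prod_def continuous_map_prod_top)
  qed (auto simp: open_map_prod_map qopen K.topspace_eq topV simp flip: qim)
  have "topological_group L V"
  proof (rule topological_groupI)
    have "continuous_map (prod_topology U U) V (\<lambda>(x, y). q (x \<otimes>\<^bsub>K\<^esub> y))"
      using continuous_map_compose[OF K.continuous_mult qcont] by (simp add: o_def case_prod_unfold)
    then have "continuous_map (prod_topology U U) V ((\<lambda>(x, y). x \<otimes>\<^bsub>L\<^esub> y) \<circ> map_prod q q)"
      by (rule continuous_map_eq) (auto simp: K.topspace_eq)
    then show "continuous_map (prod_topology V V) V (\<lambda>(x, y). x \<otimes>\<^bsub>L\<^esub> y)"
      by (rule continuous_compose_quotient_map[OF quo2])
    have "continuous_map U V (\<lambda>x. q (inv\<^bsub>K\<^esub> x))"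
      using continuous_map_compose[OF K.continuous_inv qcont] by (simp add: o_def)
    then have "continuous_map U V ((\<lambda>x. inv\<^bsub>L\<^esub> x) \<circ> q)"
      by (rule continuous_map_eq) (auto simp: K.topspace_eq)
    then show "continuous_map V V (\<lambda>x. inv\<^bsub>L\<^esub> x)"
      by (rule continuous_compose_quotient_map[OF quo])
  qed (simp_all add: topV)
  then show thesis
    by (rule that[OF _ qhom qim qeq qcont qopen])
qed

theorem c_proper_pullback_c_closed:
  fixes G :: "('a, 'm) monoid_scheme" and K :: "('k, 'n) monoid_scheme" and H :: "('h, 'l) monoid_scheme"
  assumes "c_proper G S H T f" and Kg: "topological_group_hom K U H T g"
  shows "c_closed (pullback_group G K f g) (pullback_top G S K U f g) K U snd"
proof -
  have Gf: "topological_group_hom G S H T f"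
    and test: "\<And>(L :: 'a list monoid) V g'. topological_group_hom L V H T g' \<Longrightarrow>
        c_closed (pullback_group G L f g') (pullback_top G S L V f g') L V snd"
    using assms(1) by (auto simp: c_proper_def)
  interpret G: topological_group G S using Gf by (simp add: topological_group_hom_def)
  interpret H: topological_group H T using Gf by (simp add: topological_group_hom_def)
  interpret K: topological_group K U using Kg by (simp add: topological_group_hom_def)
  interpret f: group_hom G H f using Gf by unfold_locales (simp add: topological_group_hom_def)
  interpret g: group_hom K H g using Kg by unfold_locales (simp add: topological_group_hom_def)
  have gcont: "continuous_map U T g" using Kg by (simp add: topological_group_hom_def)
  let ?Q = "pullback_group G K f g" and ?S = "pullback_set G K f g"
  interpret GK: group "G \<times>\<times> K" by (rule DirProd_group) (rule G.is_group K.is_group)+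
  have subQ: "subgroup ?S (G \<times>\<times> K)"
    by (rule subgroup_pullback_set[OF G.is_group K.is_group H.is_group f.homh g.homh])
  show ?thesis
    unfolding c_closed_def
  proof (intro conjI allI impI)
    show "topological_group_hom ?Q (pullback_top G S K U f g) K U snd"
      by (rule topological_group_hom_pullback_snd[OF Gf Kg])
  next
    fix A assume A: "subgroup A ?Q \<and> closedin (pullback_top G S K U f g) A"
    have subA: "subgroup A (G \<times>\<times> K)"
      using A subQ GK.incl_subgroup unfolding pullback_group_def by blast
    interpret A: subgroup A "G \<times>\<times> K" by (rule subA)
    have AQ: "A \<subseteq> ?S" using A subgroup.subset[of A ?Q] by (simp add: pullback_group_def)
    obtain C where C: "closedin (prod_topology S U) C" "A = C \<inter> ?S"
      using A unfolding pullback_top_def closedin_subtopology by blast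
    have A_carr: "a \<in> carrier G" "k \<in> carrier K" "f a = g k" if "(a, k) \<in> A" for a k
      using AQ that by (auto simp: pullback_set_def)
    have A_mult: "(a \<otimes>\<^bsub>G\<^esub> b, k \<otimes>\<^bsub>K\<^esub> l) \<in> A" if "(a, k) \<in> A" "(b, l) \<in> A" for a b k l
      using A.m_closed[OF that] by simp
    have A_inv: "(inv\<^bsub>G\<^esub> a, inv\<^bsub>K\<^esub> k) \<in> A" if "(a, k) \<in> A" for a k
      using A.m_inv_closed[OF that] A_carr[OF that] by (simp add: inv_DirProd G.is_group K.is_group)
    have A_one: "(\<one>\<^bsub>G\<^esub>, \<one>\<^bsub>K\<^esub>) \<in> A" using A.one_closed by simp
    define P where "P = snd ` A"
    have P: "k \<in> P \<longleftrightarrow> (\<exists>a. (a, k) \<in> A)" for k by (force simp: P_def)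
    have PK: "P \<subseteq> carrier K" using A_carr by (auto simp: P)
    have P_mult: "k \<otimes>\<^bsub>K\<^esub> l \<in> P" if "k \<in> P" "l \<in> P" for k l
      using that A_mult unfolding P by blast
    define N where "N = {k. (\<one>\<^bsub>G\<^esub>, k) \<in> A}"
    have NP: "N \<subseteq> P" by (auto simp: N_def P)
    have NK: "N \<subseteq> carrier K" using NP PK by blast
    have gN: "g n = \<one>\<^bsub>H\<^esub>" if "n \<in> N" for n using A_carr(3) that by (force simp: N_def)
    have subN: "subgroup N K"
    proof (rule K.subgroupI)
      show "N \<noteq> {}" using A_one by (auto simp: N_def)
      show "inv\<^bsub>K\<^esub> a \<in> N" if "a \<in> N" for a using that A_inv[of "\<one>\<^bsub>G\<^esub>" a] by (simp add: N_def)
      show "a \<otimes>\<^bsub>K\<^esub> b \<in> N" if "a \<in> N" "b \<in> N" for a b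
        using that A_mult[of "\<one>\<^bsub>G\<^esub>" a "\<one>\<^bsub>G\<^esub>" b] by (simp add: N_def)
    qed (rule NK)

    have N_normalized: "c k n \<in> N"
      if n: "n \<in> N" and k: "k \<in> U closure_of P"
        and c: "c = (\<lambda>k n. k \<otimes>\<^bsub>K\<^esub> n \<otimes>\<^bsub>K\<^esub> inv\<^bsub>K\<^esub> k) \<or> c = (\<lambda>k n. inv\<^bsub>K\<^esub> k \<otimes>\<^bsub>K\<^esub> n \<otimes>\<^bsub>K\<^esub> k)"
      for n k c
    proof -
      have nK: "n \<in> carrier K" using n NK by blast
      have ccarr: "c k n \<in> carrier K" if "k \<in> carrier K" for k
        using c that nK by auto
      have gc: "g (c k n) = \<one>\<^bsub>H\<^esub>" if "k \<in> carrier K" for k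
        using c that nK gN[OF n] by auto
      have "continuous_map U U (\<lambda>k. c k n)"
      proof (rule disjE[OF c])
        assume "c = (\<lambda>k n. k \<otimes>\<^bsub>K\<^esub> n \<otimes>\<^bsub>K\<^esub> inv\<^bsub>K\<^esub> k)"
        then show ?thesis
          by (auto intro!: K.continuous_map_mult K.continuous_map_inv K.continuous_map_const_carrier nK continuous_map_id[unfolded id_def])
      next
        assume "c = (\<lambda>k n. inv\<^bsub>K\<^esub> k \<otimes>\<^bsub>K\<^esub> n \<otimes>\<^bsub>K\<^esub> k)"
        then show ?thesis
          by (auto intro!: K.continuous_map_mult K.continuous_map_inv K.continuous_map_const_carrier nK continuous_map_id[unfolded id_def])
      qed
      then have "continuous_map U (prod_topology S U) (\<lambda>k. (\<one>\<^bsub>G\<^esub>, c k n))"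
        by (simp add: continuous_map_pairwise o_def G.topspace_eq)
      from closedin_continuous_map_preimage[OF this C(1)]
      have cl: "closedin U {k \<in> carrier K. (\<one>\<^bsub>G\<^esub>, c k n) \<in> C}" by (simp add: K.topspace_eq)
      have "(\<one>\<^bsub>G\<^esub>, c p n) \<in> A" if pP: "p \<in> P" for p
      proof -
        obtain a where a: "(a, p) \<in> A" using P[of p] pP by blast
        have n': "(\<one>\<^bsub>G\<^esub>, n) \<in> A" using n by (simp add: N_def)
        show ?thesis
        proof (rule disjE[OF c])
          assume "c = (\<lambda>k n. k \<otimes>\<^bsub>K\<^esub> n \<otimes>\<^bsub>K\<^esub> inv\<^bsub>K\<^esub> k)"
          then show ?thesis using A_mult[OF A_mult[OF a n'] A_inv[OF a]] A_carr(1,2)[OF a] by simp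
        next
          assume "c = (\<lambda>k n. inv\<^bsub>K\<^esub> k \<otimes>\<^bsub>K\<^esub> n \<otimes>\<^bsub>K\<^esub> k)"
          then show ?thesis using A_mult[OF A_mult[OF A_inv[OF a] n'] a] A_carr(1,2)[OF a] by simp
        qed
      qed
      then have "P \<subseteq> {k \<in> carrier K. (\<one>\<^bsub>G\<^esub>, c k n) \<in> C}" using PK C(2) by blast
      then have "U closure_of P \<subseteq> {k \<in> carrier K. (\<one>\<^bsub>G\<^esub>, c k n) \<in> C}"
        using cl by (rule closure_of_minimal)
      then have "k \<in> carrier K" "(\<one>\<^bsub>G\<^esub>, c k n) \<in> C" using k by blast+
      moreover from this(1) have "(\<one>\<^bsub>G\<^esub>, c k n) \<in> ?S"
        using gc ccarr by (simp add: pullback_set_def)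
      ultimately show ?thesis using C(2) by (simp add: N_def)
    qed

    have "x \<in> P" if x: "x \<in> U closure_of P" for x
    proof -
      have xK: "x \<in> carrier K" using x closure_of_subset_topspace[of U P] K.topspace_eq by blast
      have Pcl: "P \<subseteq> U closure_of P" by (rule closure_of_subset) (simp add: K.topspace_eq PK)
      let ?B = "insert x P"
      have BK: "?B \<subseteq> carrier K" using xK PK by blast
      have Bcl: "?B \<subseteq> U closure_of P" using x Pcl by blast
      define M where "M = generate K ?B"
      have subM: "subgroup M K" unfolding M_def by (rule K.generate_is_subgroup[OF BK])
      interpret M: subgroup M K by (rule subM)
      have BM: "?B \<subseteq> M" using generate.incl[of _ ?B K] by (auto simp: M_def)
      let ?K1 = "K\<lparr>carrier := M\<rparr>" and ?U1 = "subtopology U M"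
      interpret K1: topological_group ?K1 ?U1
        by (rule topological_group_subgroup[OF K.topological_group_axioms subM])
      have inv1: "inv\<^bsub>?K1\<^esub> k = inv\<^bsub>K\<^esub> k" if "k \<in> M" for k
        by (rule K.m_inv_consistent[OF subM that])
      have "\<forall>n\<in>N. y \<otimes>\<^bsub>K\<^esub> n \<otimes>\<^bsub>K\<^esub> inv\<^bsub>K\<^esub> y \<in> N" if "y \<in> M" for y
        using that unfolding M_def
      proof induction
        case one
        then show ?case using NK by auto
      next
        case (incl h)
        then show ?case using N_normalized Bcl by blast
      next
        case (inv h)
        then have "inv\<^bsub>K\<^esub> (inv\<^bsub>K\<^esub> h) = h" using BK by (meson K.inv_inv subsetD)
        with inv show ?case using N_normalized Bcl by fastforce
      next
        case (eng h1 h2)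
        have h: "h1 \<in> carrier K" "h2 \<in> carrier K"
          using eng(1,2) M.subset unfolding M_def by blast+
        have "h1 \<otimes>\<^bsub>K\<^esub> h2 \<otimes>\<^bsub>K\<^esub> n \<otimes>\<^bsub>K\<^esub> inv\<^bsub>K\<^esub> (h1 \<otimes>\<^bsub>K\<^esub> h2)
            = h1 \<otimes>\<^bsub>K\<^esub> (h2 \<otimes>\<^bsub>K\<^esub> n \<otimes>\<^bsub>K\<^esub> inv\<^bsub>K\<^esub> h2) \<otimes>\<^bsub>K\<^esub> inv\<^bsub>K\<^esub> h1" if "n \<in> N" for n
          using that h NK by (auto simp: K.m_assoc K.inv_mult_group subset_iff)
        then show ?case using eng by simp
      qed
      moreover have "subgroup N ?K1"
        using K.subgroup_incl[OF subN subM] NP BM by blast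
      ultimately have normN: "N \<lhd> ?K1"
        unfolding K1.normal_inv_iff by (simp add: inv1)
      interpret N1: normal N ?K1 by (rule normN)
      let ?F = "?K1 Mod N"
      let ?c = "\<lambda>k. N #>\<^bsub>?K1\<^esub> k"
      have Fgroup: "group ?F" by (rule N1.factorgroup_is_group)
      interpret F: group ?F by (rule Fgroup)
      interpret c: group_hom ?K1 ?F ?c
        using N1.r_coset_hom_Mod by unfold_locales
      have carrF: "carrier ?F = ?c ` M"
        by (auto simp: FactGroup_def RCOSETS_def)
      have c_eq: "?c p = ?c p'" if "(a, p) \<in> A" "(a, p') \<in> A" for a p p'
      proof -
        have "p \<in> M" "p' \<in> M" using that P BM by blast+
        moreover have "p \<otimes>\<^bsub>K\<^esub> inv\<^bsub>K\<^esub> p' \<in> N"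
          using A_mult[OF that(1) A_inv[OF that(2)]] A_carr[OF that(1)] by (simp add: N_def)
        moreover from calculation have "p \<otimes>\<^bsub>K\<^esub> inv\<^bsub>K\<^esub> p' \<in> carrier ?K1" using NP BM by auto
        ultimately show ?thesis
          using K1.coset_mult_inv1[OF K1.coset_join2[OF _ N1.subgroup_axioms], of p p'] N1.subset
          by (simp add: inv1)
      qed
      have "?c ` ?B \<subseteq> (\<lambda>as. case as of [] \<Rightarrow> ?c x | a # _ \<Rightarrow> ?c (SOME p. (a, p) \<in> A)) ` (UNIV :: 'a list set)"
        (is "_ \<subseteq> ?h ` _")
      proof
        fix y assume "y \<in> ?c ` ?B"
        then consider "y = ?c x" | p where "p \<in> P" "y = ?c p" by blast
        then show "y \<in> ?h ` UNIV"
        proof cases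
          case 1
          then show ?thesis by (intro image_eqI[of _ _ "[]"]) auto
        next
          case 2
          then obtain a where a: "(a, p) \<in> A" using P[of p] by blast
          then have "(a, SOME p. (a, p) \<in> A) \<in> A" by (rule someI)
          then show ?thesis using c_eq[OF a] 2 by (intro image_eqI[of _ _ "[a]"]) auto
        qed
      qed
      then have "(card_of (?c ` ?B), card_of (UNIV :: 'a list set)) \<in> ordLeq"
        by (rule surj_imp_ordLeq)
      moreover have "?c ` ?B \<subseteq> carrier ?F" using carrF BM by blast
      ultimately have "(card_of (generate ?F (?c ` ?B)), card_of (UNIV :: 'a list set)) \<in> ordLeq"
        by (intro card_of_generate Fgroup infinite_UNIV_listI)
      moreover have "generate ?F (?c ` ?B) = carrier ?F"
      proof -
        have "?B \<subseteq> carrier ?K1" using BM by simp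
        from c.generate_img[OF this] have "generate ?F (?c ` ?B) = ?c ` generate ?K1 ?B" .
        also have "generate ?K1 ?B = M"
          using K.generate_consistent[OF BM subM] by (simp add: M_def)
        finally show ?thesis using carrF by simp
      qed
      ultimately obtain e :: "'k set \<Rightarrow> 'a list" where e: "inj_on e (carrier ?F)"
        unfolding card_of_ordLeq[symmetric] by auto
      obtain L :: "'a list monoid" and V q where L: "topological_group L V"
        and q: "q \<in> hom ?K1 L" "q ` carrier ?K1 = carrier L"
        and q_eq1: "\<And>x y. x \<in> carrier ?K1 \<Longrightarrow> y \<in> carrier ?K1 \<Longrightarrow>
              q x = q y \<longleftrightarrow> x \<otimes>\<^bsub>?K1\<^esub> inv\<^bsub>?K1\<^esub> y \<in> N"
        and qcont: "continuous_map ?U1 V q" and qopen: "open_map ?U1 V q"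
        by (rule topological_group_quotient[OF K1.topological_group_axioms normN e]) blast
      interpret L: topological_group L V by (rule L)
      interpret q: group_hom ?K1 L q by unfold_locales (rule q(1))
      have qM: "q ` M = carrier L" using q(2) by simp
      have q_eq: "\<exists>n\<in>N. k = n \<otimes>\<^bsub>K\<^esub> l" if "k \<in> M" "l \<in> M" "q k = q l" for k l
        using q_eq1[of k l] that inv1[of l]
        by (intro bexI[of _ "k \<otimes>\<^bsub>K\<^esub> inv\<^bsub>K\<^esub> l"]) (auto simp: K.m_assoc)
      have topU1: "topspace ?U1 = M" using K1.topspace_eq by simp
      have quo: "quotient_map ?U1 V q"
        by (rule continuous_open_imp_quotient_map[OF qcont qopen]) (simp only: topU1 L.topspace_eq qM)
      define g' where "g' = (\<lambda>l. g (inv_into M q l))"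
      have g'q: "g' (q k) = g k" if kM: "k \<in> M" for k
      proof -
        have "inv_into M q (q k) \<in> M" "q (inv_into M q (q k)) = q k"
          using that by (auto intro: inv_into_into f_inv_into_f)
        then obtain n where "n \<in> N" "inv_into M q (q k) = n \<otimes>\<^bsub>K\<^esub> k" using q_eq kM by blast
        then show ?thesis using gN NK kM M.subset by (auto simp: g'_def subset_iff)
      qed
      have g'hom: "topological_group_hom L V H T g'"
        unfolding topological_group_hom_def
      proof (intro conjI)
        show "topological_group L V" by (rule L)
        show "topological_group H T" by unfold_locales
        show "g' \<in> hom L H"
        proof (rule homI)
          fix l assume "l \<in> carrier L"
          then obtain k where "k \<in> M" "l = q k" using qM by blast
          then show "g' l \<in> carrier H" using g'q by auto
        next
          fix l l' assume "l \<in> carrier L" "l' \<in> carrier L"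
          then obtain k k' where k: "k \<in> M" "l = q k" "k' \<in> M" "l' = q k'" using qM by blast
          then have "l \<otimes>\<^bsub>L\<^esub> l' = q (k \<otimes>\<^bsub>K\<^esub> k')" using q.hom_mult[of k k'] by simp
          then show "g' (l \<otimes>\<^bsub>L\<^esub> l') = g' l \<otimes>\<^bsub>H\<^esub> g' l'" using k g'q by simp
        qed
        have "continuous_map ?U1 T g" by (rule continuous_map_from_subtopology[OF gcont])
        then have "continuous_map ?U1 T (g' \<circ> q)"
          by (rule continuous_map_eq) (simp only: topU1 o_def g'q)
        then show "continuous_map V T g'" by (rule continuous_compose_quotient_map[OF quo])
      qed
      let ?S' = "pullback_set G L f g'"
      let ?m = "map_prod (\<lambda>a. a) q"
      define A' where "A' = ?m ` A"
      have AM: "k \<in> M" if "(a, k) \<in> A" for a k using that P BM by blast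
      have A': "(a, l) \<in> A' \<longleftrightarrow> (\<exists>k. (a, k) \<in> A \<and> l = q k)" for a l
        by (force simp: A'_def)
      have A'S: "A' \<subseteq> ?S'"
      proof (rule subrelI)
        fix a l assume "(a, l) \<in> A'"
        then obtain k where k: "(a, k) \<in> A" "l = q k" using A' by blast
        then show "(a, l) \<in> ?S'" using A_carr[OF k(1)] AM[OF k(1)] g'q qM by (auto simp: pullback_set_def)
      qed
      have pbL: "pullback_group G L f g' = (G \<times>\<times> L)\<lparr>carrier := ?S'\<rparr>" by (simp add: pullback_group_def)
      interpret GL: group "G \<times>\<times> L" by (rule DirProd_group) (rule G.is_group L.is_group)+
      have subS': "subgroup ?S' (G \<times>\<times> L)"
        using g'hom by (intro subgroup_pullback_set[OF G.is_group L.is_group H.is_group f.homh])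
          (simp add: topological_group_hom_def)
      have "subgroup A' (G \<times>\<times> L)"
      proof (rule GL.subgroupI)
        show "A' \<subseteq> carrier (G \<times>\<times> L)" using A'S subgroup.subset[OF subS'] by blast
        show "A' \<noteq> {}" using A_one by (auto simp: A'_def)
      next
        fix z assume "z \<in> A'"
        then obtain a k where k: "(a, k) \<in> A" "z = (a, q k)" using A' by (cases z) blast
        then have "inv\<^bsub>G \<times>\<times> L\<^esub> z = (inv\<^bsub>G\<^esub> a, q (inv\<^bsub>K\<^esub> k))"
          using A_carr[OF k(1)] AM[OF k(1)] q.hom_inv[of k] inv1[of k] qM
          by (auto simp: inv_DirProd G.is_group L.is_group)
        then show "inv\<^bsub>G \<times>\<times> L\<^esub> z \<in> A'" using A' A_inv[OF k(1)] by auto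
      next
        fix z z' assume "z \<in> A'" "z' \<in> A'"
        then obtain a k a' k' where k: "(a, k) \<in> A" "z = (a, q k)" "(a', k') \<in> A" "z' = (a', q k')"
          using A' by (cases z, cases z') blast
        then have "z \<otimes>\<^bsub>G \<times>\<times> L\<^esub> z' = (a \<otimes>\<^bsub>G\<^esub> a', q (k \<otimes>\<^bsub>K\<^esub> k'))"
          using AM[OF k(1)] AM[OF k(3)] q.hom_mult[of k k'] by simp
        then show "z \<otimes>\<^bsub>G \<times>\<times> L\<^esub> z' \<in> A'" using A' A_mult[OF k(1,3)] by auto
      qed
      then have sub: "subgroup A' (pullback_group G L f g')"
        unfolding pbL using GL.subgroup_incl subS' A'S by blast
      define W where "W = carrier G \<times> M - C"
      have Wopen: "openin (prod_topology S ?U1) W"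
      proof -
        have "W = (topspace (prod_topology S U) - C) \<inter> (UNIV \<times> M)"
          using M.subset by (auto simp: W_def G.topspace_eq K.topspace_eq)
        moreover have "openin (prod_topology S U) (topspace (prod_topology S U) - C)"
          using C(1) by blast
        moreover have "prod_topology S ?U1 = subtopology (prod_topology S U) (UNIV \<times> M)"
          by (simp add: subtopology_Times)
        ultimately show ?thesis by (auto simp: openin_subtopology)
      qed
      have "open_map (prod_topology S ?U1) (prod_topology S V) ?m"
        by (rule open_map_prod_map[OF _ qopen]) (simp add: open_map_def)
      then have mW: "openin (prod_topology S V) (?m ` W)" using Wopen by (simp add: open_map_def)
      have "A' = (topspace (prod_topology S V) - ?m ` W) \<inter> ?S'"
      proof (intro equalityI subsetI)
        fix z assume z: "z \<in> A'"
        then obtain a k where k: "(a, k) \<in> A" "z = (a, q k)" using A' by (cases z) blast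
        have "z \<notin> ?m ` W"
        proof
          assume "z \<in> ?m ` W"
          then obtain k' where k': "(a, k') \<in> W" "q k = q k'" using k by auto
          then have "k' \<in> M" by (auto simp: W_def)
          then obtain n where n: "n \<in> N" "k' = n \<otimes>\<^bsub>K\<^esub> k" using q_eq[of k' k] AM[OF k(1)] k' by auto
          then have "(a, k') \<in> A" using A_mult[of "\<one>\<^bsub>G\<^esub>" n a k] k(1) A_carr[OF k(1)] by (simp add: N_def)
          then show False using k'(1) C(2) by (auto simp: W_def)
        qed
        then show "z \<in> (topspace (prod_topology S V) - ?m ` W) \<inter> ?S'"
          using z A'S subgroup.subset[OF subS'] by (auto simp: G.topspace_eq L.topspace_eq)
      next
        fix z assume z: "z \<in> (topspace (prod_topology S V) - ?m ` W) \<inter> ?S'"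
        obtain a l where al: "z = (a, l)" by (cases z)
        with z have alS: "a \<in> carrier G" "l \<in> carrier L" "f a = g' l" by (auto simp: pullback_set_def)
        then obtain k where k: "k \<in> M" "l = q k" using qM by blast
        then have "(a, k) \<notin> W" using z al by force
        then have "(a, k) \<in> C" using alS k by (simp add: W_def)
        moreover have "(a, k) \<in> ?S" using alS k g'q M.subset by (auto simp: pullback_set_def)
        ultimately show "z \<in> A'" using C(2) al k A' by blast
      qed
      then have "closedin (pullback_top G S L V f g') A'"
        unfolding pullback_top_def closedin_subtopology using mW by blast
      with sub have "closedin V (snd ` A')" using test[OF g'hom] by (simp add: c_closed_def)
      moreover have "snd ` A' = q ` P" by (simp add: A'_def P_def image_image)
      ultimately have "closedin V (q ` P)" by simp
      from closedin_continuous_map_preimage[OF qcont this]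
      have "closedin ?U1 {k \<in> M. q k \<in> q ` P}" by (simp only: topU1)
      moreover have "{k \<in> M. q k \<in> q ` P} = P"
      proof (intro equalityI subsetI)
        fix k assume "k \<in> {k \<in> M. q k \<in> q ` P}"
        then obtain p where p: "k \<in> M" "p \<in> P" "q k = q p" by blast
        then obtain n where "n \<in> N" "k = n \<otimes>\<^bsub>K\<^esub> p" using q_eq[of k p] BM by blast
        then show "k \<in> P" using P_mult NP p by blast
      qed (use BM in auto)
      ultimately obtain D where D: "closedin U D" "P = D \<inter> M" by (auto simp: closedin_subtopology)
      then have "U closure_of P \<subseteq> D" by (intro closure_of_minimal) auto
      then show "x \<in> P" using x D(2) BM by blast
    qed
    then have "U closure_of P \<subseteq> P" by blast
    then show "closedin U (snd ` A)"
      unfolding P_def[symmetric] using PK by (metis K.topspace_eq closedin_closure_of closure_of_subset subset_antisym)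
  qed
qed

lemma c_compact_imp_topological_group:
  "c_compact G S \<Longrightarrow> topological_group G S"
  by (simp add: c_compact_def c_proper_def topological_group_hom_def)

corollary c_compact_DirProd_c_closed:
  assumes "c_compact G S" "topological_group K U"
  shows "c_closed (G \<times>\<times> K) (prod_topology S U) K U snd"
proof -
  interpret G: topological_group G S by (rule c_compact_imp_topological_group) fact
  interpret K: topological_group K U by fact
  have *: "pullback_set G K (\<lambda>_. ()) (\<lambda>_. ()) = carrier G \<times> carrier K"
    by (auto simp: pullback_set_def)
  have "pullback_group G K (\<lambda>_. ()) (\<lambda>_. ()) = G \<times>\<times> K"
    by (simp add: pullback_group_def * DirProd_def)
  moreover have "pullback_top G S K U (\<lambda>_. ()) (\<lambda>_. ()) = prod_topology S U"
    unfolding pullback_top_def *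
    by (rule subtopology_superset) (simp add: G.topspace_eq K.topspace_eq)
  ultimately show ?thesis
    using c_proper_pullback_c_closed[OF assms(1)[unfolded c_compact_def]
        topological_group_hom_singleton[OF assms(2)]] by simp
qed

end

theory Submission
  imports Defs
begin

text \<open>
  For a test group \<open>L\<close>, reassociation identifies \<open>(G \<times>\<^sub>H K) \<times> L\<close> with \<open>G \<times>\<^sub>H (K \<times> L)\<close>, so that
  its projection to \<open>L\<close> factors through \<open>K \<times> L\<close>: the first factor is a pullback of \<open>f\<close>, hence
  c-closed, and the second one is c-closed because \<open>K\<close> is c-compact.
\<close>

lemma topological_group_hom_fst:
  assumes "topological_group G S" "topological_group K U"
  shows "topological_group_hom (G \<times>\<times> K) (prod_topology S U) G S fst"
  using assms topological_group_DirProd[OF assms]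
  by (auto simp: topological_group_hom_def hom_def continuous_map_fst)

lemma topological_group_hom_compose:
  assumes "topological_group_hom G S H T f" "topological_group_hom H T K U g"
  shows "topological_group_hom G S K U (g \<circ> f)"
  using assms by (auto simp: topological_group_hom_def intro: hom_compose continuous_map_compose)

lemma (in group_hom) subgroup_preimage:
  assumes "subgroup A H"
  shows "subgroup {x \<in> carrier G. h x \<in> A} G"
proof -
  interpret A: subgroup A H by fact
  show ?thesis by (rule G.subgroupI) (auto intro!: exI[of _ "\<one>\<^bsub>G\<^esub>"])
qed

text \<open>This makes c-closed maps composable: the image of a closed subgroup is again a closed
  subgroup, so the next c-closed map can be applied to it.\<close>

lemma c_closed_image:
  assumes "c_closed G S H T f" "subgroup A G" "closedin S A"
  shows "subgroup (f ` A) H" "closedin T (f ` A)"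
proof -
  have "group_hom G H f"
    using assms(1) by (simp add: c_closed_def topological_group_hom_def topological_group_def
        group_hom_def group_hom_axioms_def)
  then show "subgroup (f ` A) H" using assms(2) by (rule group_hom.subgroup_img_is_subgroup)
  show "closedin T (f ` A)" using assms by (simp add: c_closed_def)
qed

text \<open>As \<open>k\<close> maps to the trivial group, the outer pullback in the target is the
  full product with \<open>L\<close>. Only this direction of the reassociation is needed, since
  closed subgroups will be pulled back along it.\<close>

lemma topological_group_hom_pullback_assoc:
  assumes f: "topological_group_hom G S H T f" and g: "topological_group_hom K U H T g"
    and k: "topological_group_hom L V (singleton_group ()) (discrete_topology {()}) k"
  shows "topological_group_hom
     (pullback_group G (K \<times>\<times> L) f (g \<circ> fst)) (pullback_top G S (K \<times>\<times> L) (prod_topology U V) f (g \<circ> fst))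
     (pullback_group (pullback_group G K f g) L (\<lambda>_. ()) k)
     (pullback_top (pullback_group G K f g) (pullback_top G S K U f g) L V (\<lambda>_. ()) k)
     (\<lambda>(x, y, z). ((x, y), z))" (is "topological_group_hom ?P ?X ?Q ?Y ?r")
proof -
  have K: "topological_group K U" and L: "topological_group L V"
    using g k by (simp_all add: topological_group_hom_def)
  have gf: "topological_group_hom (K \<times>\<times> L) (prod_topology U V) H T (g \<circ> fst)"
    by (rule topological_group_hom_compose[OF topological_group_hom_fst[OF K L] g])
  show ?thesis
    unfolding topological_group_hom_def
  proof (intro conjI)
    show "topological_group ?P ?X" by (rule topological_group_pullback[OF f gf])
    show "topological_group ?Q ?Y"
      by (rule topological_group_pullback[OF topological_group_hom_singleton k])
        (rule topological_group_pullback[OF f g])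
    show "?r \<in> hom ?P ?Q"
      by (auto simp: hom_def pullback_group_def pullback_set_def)
    let ?Z = "prod_topology S (prod_topology U V)"
    have "continuous_map ?Z U (\<lambda>p. fst (snd p))" "continuous_map ?Z V (\<lambda>p. snd (snd p))"
      using continuous_map_compose[OF continuous_map_snd continuous_map_fst, of S U V]
        continuous_map_compose[OF continuous_map_snd continuous_map_snd, of S U V]
      by (simp_all add: o_def)
    then have "continuous_map ?Z (prod_topology (prod_topology S U) V) (\<lambda>p. ((fst p, fst (snd p)), snd (snd p)))"
      by (simp add: continuous_map_pairwise o_def continuous_map_fst)
    \<comment> \<open>Nested subspaces flatten, so \<open>?Y\<close> is a subspace of the
      reassociated triple product. Continuity on all of \<open>?Z\<close> then restricts to
      \<open>?X\<close>.\<close>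
    then show "continuous_map ?X ?Y ?r"
      unfolding pullback_top_def
      by (auto simp: continuous_map_in_subtopology prod_topology_subtopology subtopology_subtopology
          pullback_group_def pullback_set_def case_prod_unfold intro: continuous_map_from_subtopology)
  qed
qed

theorem corollary2p13:
  fixes G :: "('a, 'm) monoid_scheme" and S :: "'a topology"
    and H :: "('h, 'n) monoid_scheme" and T :: "'h topology"
    and K :: "('k, 'p) monoid_scheme" and U :: "'k topology"
    and f :: "'a \<Rightarrow> 'h" and g :: "'k \<Rightarrow> 'h"
  assumes "topological_group_hom G S H T f"
    and "topological_group_hom K U H T g"
    and "c_proper G S H T f"
    and "c_compact K U"
  shows "c_compact (pullback_group G K f g) (pullback_top G S K U f g)"
proof -
  let ?P = "pullback_group G K f g" and ?X = "pullback_top G S K U f g"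
  have hom: "topological_group_hom ?P ?X (singleton_group ()) (discrete_topology {()}) (\<lambda>_. ())"
    by (rule topological_group_hom_singleton[OF topological_group_pullback[OF assms(1,2)]])
  \<comment> \<open>The definition prescribes test groups of lists over the element type of the
    pullback. Neither \<open>L\<close> nor \<open>K \<times>\<times> L\<close> is thus of the type
    used in the definitions for \<open>K\<close> and \<open>f\<close>, so both hypotheses are
    applied below in their forms for arbitrary types.\<close>
  have "c_closed (pullback_group ?P L (\<lambda>_. ()) k) (pullback_top ?P ?X L V (\<lambda>_. ()) k) L V snd"
    if k: "topological_group_hom L V (singleton_group ()) (discrete_topology {()}) k"
    for L :: "('a \<times> 'k) list monoid" and V k
    unfolding c_closed_def
  proof (intro conjI allI impI)
    show "topological_group_hom (pullback_group ?P L (\<lambda>_. ()) k) (pullback_top ?P ?X L V (\<lambda>_. ()) k) L V snd"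
      by (rule topological_group_hom_pullback_snd[OF hom k])
    fix A assume A: "subgroup A (pullback_group ?P L (\<lambda>_. ()) k) \<and> closedin (pullback_top ?P ?X L V (\<lambda>_. ()) k) A"
    have K: "topological_group K U" and L: "topological_group L V"
      using assms(2) k by (simp_all add: topological_group_hom_def)
    let ?Q = "pullback_group G (K \<times>\<times> L) f (g \<circ> fst)"
    let ?Y = "pullback_top G S (K \<times>\<times> L) (prod_topology U V) f (g \<circ> fst)"
    let ?r = "\<lambda>(x, y, z). ((x, y), z)"
    \<comment> \<open>\<open>B\<close> is \<open>A\<close> seen inside the pullback of
      \<open>f\<close> along \<open>g \<circ> fst\<close>. As a preimage under a continuous
      homomorphism it is a closed subgroup.\<close>
    define B where "B = {p \<in> carrier ?Q. ?r p \<in> A}"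
    note r = topological_group_hom_pullback_assoc[OF assms(1,2) k, unfolded topological_group_hom_def]
    then have "group_hom ?Q (pullback_group ?P L (\<lambda>_. ()) k) ?r"
      by (simp add: topological_group_def group_hom_def group_hom_axioms_def)
    then have "subgroup B ?Q" unfolding B_def using A by (intro group_hom.subgroup_preimage) auto
    moreover have "topspace ?Y = carrier ?Q" using r topological_group.topspace_eq by blast
    then have "closedin ?Y B"
      unfolding B_def using closedin_continuous_map_preimage[of ?Y _ ?r A] r A by auto
    moreover have "c_closed ?Q ?Y (K \<times>\<times> L) (prod_topology U V) snd"
      by (rule c_proper_pullback_c_closed[OF assms(3)
            topological_group_hom_compose[OF topological_group_hom_fst[OF K L] assms(2)]])
    \<comment> \<open>The inner projection of \<open>B\<close> is a closed subgroup of
      \<open>K \<times>\<times> L\<close>, to which c-compactness of \<open>K\<close>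
      applies.\<close>
    ultimately have "closedin V (snd ` snd ` B)"
      by (intro c_closed_image(2)[OF c_compact_DirProd_c_closed[OF assms(4) L]] c_closed_image)
    \<comment> \<open>Every element of \<open>A\<close> is hit by \<open>?r\<close>, which preserves
      the \<open>L\<close> coordinate, so passing to \<open>B\<close> loses no point of the
      projection.\<close>
    moreover have "A \<subseteq> carrier (pullback_group ?P L (\<lambda>_. ()) k)" using A subgroup.subset by blast
    then have "snd ` snd ` B = snd ` A"
      by (force simp: B_def pullback_group_def pullback_set_def)
    ultimately show "closedin V (snd ` A)" by simp
  qed
  with hom show ?thesis by (simp add: c_compact_def c_proper_def)
qed

end
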